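(* Let universal constants $C,C'>0$ be given, let $\bar\varepsilon>0$, and consider an instance $(x_0,(f,f';h))$ with $x_0\in\operatorname{dom}h$ such that $(f,f';h)$ satisfies the basic assumptions with a parameter triple $(M_f,M_h,\mu)$ such that $$\frac{CM_fd_0}{\bar\varepsilon}\ge1,\qquad M_h\in[0,+\infty],\qquad 0\le\mu\le\frac{C'M_f}{d_0}.$$ Then the interval $\frac{d_0}{M_f}\le\lambda\le\frac{Cd_0^2}{\bar\varepsilon}$ is nonempty, and for any $\lambda$ in it, RPB$(x_0,\lambda,\bar\varepsilon/2)$ has $\bar\varepsilon$-iteration complexity bound $$\mathcal{O}_1\left(\min\left\{\frac{M_f^2d_0^2}{\bar\varepsilon^2},\ \left(\frac{M_f^2}{\mu\bar\varepsilon}+1\right)\log\left(\frac{\mu d_0^2}{\bar\varepsilon}+1\right)\right\}\right),$$ i.e. the total number of (serious and null) iterations performed until some $\hat z_k$ with $\phi(\hat z_k)-\phi^*\le\bar\varepsilon$ is obtained is at most a constant, depending only on $C$ and $C'$, times one plus the displayed minimum.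
   Context: Problem: $\phi^*:=\min\{\phi(x):=f(x)+h(x):x\in\mathbb{R}^n\}$. We say $(f,f';h)$ satisfies the basic assumptions with parameters $(M_f,M_h,\mu)\in\mathbb{R}_+\times[0,\infty]\times\mathbb{R}_+$ if: (i) $f,h:\mathbb{R}^n\to(-\infty,+\infty]$ are proper lower semicontinuous convex, $\operatorname{dom}h\subset\operatorname{dom}f$, and $f':\operatorname{dom}h\to\mathbb{R}^n$ satisfies $f'(x)\in\partial f(x)$ for all $x\in\operatorname{dom}h$; (ii) the set $X^*$ of minimizers of $\phi$ is nonempty; (iii) $h$ is $\mu$-convex, i.e. $h(\alpha z+(1-\alpha)u)\le\alpha h(z)+(1-\alpha)h(u)-\frac{\alpha(1-\alpha)\mu}{2}\|z-u\|^2$ for all $z,u\in\operatorname{dom}h$, $\alpha\in[0,1]$, and $\|f'(x)\|\le M_f$ for all $x\in\operatorname{dom}h$; (iv) $|h(u)-h(v)|\le M_h\|u-v\|$ for all $u,v\in\operatorname{dom}h$ ($M_h=\infty$ is allowed, imposing no condition). Here $\|\cdot\|$ is the Euclidean norm. $d_0:=\inf\{\|x_0-x^*\|:x^*\in X^*\}$. Method RPB$(x_0,\lambda,\delta)$ ($x_0\in\operatorname{dom}h$, $\lambda>0$, $\delta>0$). Set $x_0^c=\tilde x_0=\hat z_0=x_0$, $C_1=\{x_0\}$, $k=1$. For $j=1,2,\dots$: let $f_j(u)=\max\{f(x)+\langle f'(x),u-x\rangle:x\in C_j\}$; let $x_j$ be the unique minimizer and $m_j$ the minimum value over $u\in\mathbb{R}^n$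 of $f_j(u)+h(u)+\frac1{2\lambda}\|u-x_{j-1}^c\|^2$; let $\phi_j^\lambda:=\phi+\frac1{2\lambda}\|\cdot-x_{j-1}^c\|^2$; choose $\tilde x_j\in\operatorname{Argmin}\{\phi_j^\lambda(u):u\in\{x_j,\tilde x_{j-1}\}\}$; let $t_j:=\phi_j^\lambda(\tilde x_j)-m_j$. If $t_j\le\delta$ (iteration $j$ is serious): choose any finite $C_{j+1}$ with $\{x_j\}\subset C_{j+1}\subset\{x_0,\dots,x_j\}$, set $x_j^c=x_j$, choose $\hat z_k\in\operatorname{Argmin}\{\phi(u):u\in\{\hat z_{k-1},\tilde x_j\}\}$, and increase $k$ by 1. Otherwise (iteration $j$ is null): set $x_j^c=x_{j-1}^c$ and choose any $C_{j+1}$ with $A_j\cup\{x_j\}\subset C_{j+1}\subset C_j\cup\{x_j\}$, where $A_j:=\{x\in C_j:f(x)+\langle f'(x),x_j-x\rangle=f_j(x_j)\}$. The statement holds for all admissible choices. $p=\mathcal{O}_1(q)$ means $p\le\bar c\,(q+1)$ for a constant $\bar c$. Convention: when $\mu=0$, the second term in the minimum is understood to equal the first one. *)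

theory Defs
  imports "HOL-Analysis.Analysis"
begin

text \<open>
  The complexity constant must not depend on the dimension, so the dimension \<open>n\<close> has to be
  quantified inside the statement.  Hence \<open>\<real>\<^sup>n\<close> is the carrier of the library topology
  \<^const>\<open>Euclidean_space\<close>, i.e. the sequences vanishing from index \<open>n\<close> on.  Its elements
  are not in a normed type (and \<^const>\<open>dist\<close> on functions is a different, product metric),
  so inner product and Euclidean norm are given explicitly.
\<close>

type_synonym point = "nat \<Rightarrow> real"

abbreviation Rn :: "nat \<Rightarrow> point set" where
  "Rn n \<equiv> topspace (Euclidean_space n)"

definition inner_n :: "nat \<Rightarrow> point \<Rightarrow> point \<Rightarrow> real" where
  "inner_n n x y = (\<Sum>i<n. x i * y i)"

definition norm_n :: "nat \<Rightarrow> point \<Rightarrow> real" where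
  "norm_n n x = L2_set x {..<n}"

definition comb :: "real \<Rightarrow> point \<Rightarrow> point \<Rightarrow> point" where
  "comb \<alpha> z u = (\<lambda>i. \<alpha> * z i + (1 - \<alpha>) * u i)"

definition edom :: "nat \<Rightarrow> (point \<Rightarrow> ereal) \<Rightarrow> point set" where
  "edom n g = {x \<in> Rn n. g x < \<infinity>}"

definition proper_fun :: "nat \<Rightarrow> (point \<Rightarrow> ereal) \<Rightarrow> bool" where
  "proper_fun n g \<longleftrightarrow> (\<forall>x\<in>Rn n. g x \<noteq> -\<infinity>) \<and> edom n g \<noteq> {}"

definition lsc_fun :: "nat \<Rightarrow> (point \<Rightarrow> ereal) \<Rightarrow> bool" where
  "lsc_fun n g \<longleftrightarrow> (\<forall>a::real. closedin (Euclidean_space n) {x \<in> Rn n. g x \<le> ereal a})"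

text \<open>For \<open>\<alpha> \<in> {0, 1}\<close> and an infinite value, the convention \<open>0 * \<infinity> = 0\<close> of
  \<^typ>\<open>ereal\<close> is the usual one of convex analysis.\<close>

definition convex_fun :: "nat \<Rightarrow> (point \<Rightarrow> ereal) \<Rightarrow> bool" where
  "convex_fun n g \<longleftrightarrow> (\<forall>z\<in>Rn n. \<forall>u\<in>Rn n. \<forall>\<alpha>\<in>{0..1}.
     g (comb \<alpha> z u) \<le> ereal \<alpha> * g z + ereal (1 - \<alpha>) * g u)"

definition subdiff :: "nat \<Rightarrow> (point \<Rightarrow> ereal) \<Rightarrow> point \<Rightarrow> point set" where
  "subdiff n g x = {v \<in> Rn n. \<forall>u\<in>Rn n. g x + ereal (inner_n n v (u - x)) \<le> g u}"

definition minimizers :: "nat \<Rightarrow> (point \<Rightarrow> ereal) \<Rightarrow> point set" where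
  "minimizers n g = {x. is_arg_min g (\<lambda>u. u \<in> Rn n) x}"

definition phi :: "(point \<Rightarrow> ereal) \<Rightarrow> (point \<Rightarrow> ereal) \<Rightarrow> point \<Rightarrow> ereal" where
  "phi f h x = f x + h x"

definition opt_value :: "nat \<Rightarrow> (point \<Rightarrow> ereal) \<Rightarrow> ereal" where
  "opt_value n g = (INF u\<in>Rn n. g u)"

definition dist0 :: "nat \<Rightarrow> (point \<Rightarrow> ereal) \<Rightarrow> (point \<Rightarrow> ereal) \<Rightarrow> point \<Rightarrow> real" where
  "dist0 n f h x0 = (INF xs\<in>minimizers n (phi f h). norm_n n (x0 - xs))"

text \<open>\<open>Mh = \<infinity>\<close> makes the last assumption vacuous (for \<open>u = v\<close> again by \<open>\<infinity> * 0 = 0\<close>).\<close>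

locale basic_assumptions =
  fixes n :: nat and f :: "point \<Rightarrow> ereal" and f' :: "point \<Rightarrow> point" and h :: "point \<Rightarrow> ereal"
    and Mf :: real and Mh :: ereal and \<mu> :: real
  assumes params: "0 \<le> Mf" "0 \<le> Mh" "0 \<le> \<mu>"
    and f_fun: "proper_fun n f" "lsc_fun n f" "convex_fun n f"
    and h_fun: "proper_fun n h" "lsc_fun n h" "convex_fun n h"
    and dom: "edom n h \<subseteq> edom n f"
    and subgradient: "\<And>x. x \<in> edom n h \<Longrightarrow> f' x \<in> subdiff n f x"
    and minimizer: "minimizers n (phi f h) \<noteq> {}"
    and mu_convex: "\<And>z u \<alpha>. \<lbrakk>z \<in> edom n h; u \<in> edom n h; \<alpha> \<in> {0..1}\<rbrakk> \<Longrightarrow>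
      h (comb \<alpha> z u) \<le> ereal \<alpha> * h z + ereal (1 - \<alpha>) * h u
        - ereal (\<alpha> * (1 - \<alpha>) * \<mu> / 2 * (norm_n n (z - u))\<^sup>2)"
    and subgradient_bound: "\<And>x. x \<in> edom n h \<Longrightarrow> norm_n n (f' x) \<le> Mf"
    and h_Lipschitz: "\<And>u v. \<lbrakk>u \<in> edom n h; v \<in> edom n h\<rbrakk> \<Longrightarrow>
      \<bar>h u - h v\<bar> \<le> Mh * ereal (norm_n n (u - v))"

definition cut :: "nat \<Rightarrow> (point \<Rightarrow> ereal) \<Rightarrow> (point \<Rightarrow> point) \<Rightarrow> point \<Rightarrow> point \<Rightarrow> ereal" where
  "cut n f f' x u = f x + ereal (inner_n n (f' x) (u - x))"

definition model :: "nat \<Rightarrow> (point \<Rightarrow> ereal) \<Rightarrow> (point \<Rightarrow> point) \<Rightarrow> point set \<Rightarrow> point \<Rightarrow> ereal" where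
  "model n f f' C u = (MAX x\<in>C. cut n f f' x u)"

definition prox :: "nat \<Rightarrow> real \<Rightarrow> point \<Rightarrow> (point \<Rightarrow> ereal) \<Rightarrow> point \<Rightarrow> ereal" where
  "prox n lam c g u = g u + ereal (1 / (2 * lam) * (norm_n n (u - c))\<^sup>2)"

text \<open>
  All admissible executions of RPB.  The sequences \<open>x\<close>, \<open>xc\<close>, \<open>xt\<close>, \<open>C\<close> are indexed by the
  iteration (\<open>x\<^sub>j\<close>, \<open>x\<^sub>j\<^sup>c\<close>, \<open>\<open>x\<close>-tilde\<^sub>j\<close>, \<open>C\<^sub>j\<close>; \<open>C 0\<close> is unused), while \<open>zh\<close> is indexed by the
  cycle counter; \<open>kc j\<close> is the value of that counter after \<open>j\<close> iterations, so \<open>zh 0, \<dots>,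
  zh (kc j - 1)\<close> are the points \<open>z\<close>-hat available by then.
\<close>

locale rpb_run =
  fixes n :: nat and f :: "point \<Rightarrow> ereal" and f' :: "point \<Rightarrow> point" and h :: "point \<Rightarrow> ereal"
    and x0 :: point and lam \<delta> :: real
    and x xc xt :: "nat \<Rightarrow> point" and C :: "nat \<Rightarrow> point set"
    and zh :: "nat \<Rightarrow> point" and kc :: "nat \<Rightarrow> nat" and m t :: "nat \<Rightarrow> ereal"
  assumes init: "x 0 = x0" "xc 0 = x0" "xt 0 = x0" "zh 0 = x0" "C 1 = {x0}" "kc 0 = 1"
    and subproblem: "\<And>j. 1 \<le> j \<Longrightarrow>
      is_arg_min (prox n lam (xc (j - 1)) (\<lambda>u. model n f f' (C j) u + h u)) (\<lambda>u. u \<in> Rn n) (x j)"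
    and m_eq: "\<And>j. 1 \<le> j \<Longrightarrow>
      m j = prox n lam (xc (j - 1)) (\<lambda>u. model n f f' (C j) u + h u) (x j)"
    and xt_choice: "\<And>j. 1 \<le> j \<Longrightarrow>
      is_arg_min (prox n lam (xc (j - 1)) (phi f h)) (\<lambda>u. u \<in> {x j, xt (j - 1)}) (xt j)"
    and t_eq: "\<And>j. 1 \<le> j \<Longrightarrow> t j = prox n lam (xc (j - 1)) (phi f h) (xt j) - m j"
    and serious: "\<And>j. \<lbrakk>1 \<le> j; t j \<le> ereal \<delta>\<rbrakk> \<Longrightarrow>
      finite (C (Suc j)) \<and> {x j} \<subseteq> C (Suc j) \<and> C (Suc j) \<subseteq> x ` {0..j} \<and>
      xc j = x j \<and>
      is_arg_min (phi f h) (\<lambda>u. u \<in> {zh (kc (j - 1) - 1), xt j}) (zh (kc (j - 1))) \<and>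
      kc j = kc (j - 1) + 1"
    and null: "\<And>j. \<lbrakk>1 \<le> j; \<not> t j \<le> ereal \<delta>\<rbrakk> \<Longrightarrow>
      {y \<in> C j. cut n f f' y (x j) = model n f f' (C j) (x j)} \<union> {x j} \<subseteq> C (Suc j) \<and>
      C (Suc j) \<subseteq> C j \<union> {x j} \<and>
      xc j = xc (j - 1) \<and>
      kc j = kc (j - 1)"

text \<open>The iteration count includes both serious and null iterations; \<open>zh 0 = x0\<close> costs none.\<close>

definition rpb_complexity_bound ::
  "nat \<Rightarrow> (point \<Rightarrow> ereal) \<Rightarrow> (point \<Rightarrow> point) \<Rightarrow> (point \<Rightarrow> ereal) \<Rightarrow> point \<Rightarrow>
   real \<Rightarrow> real \<Rightarrow> real \<Rightarrow> real \<Rightarrow> bool" where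
  "rpb_complexity_bound n f f' h x0 lam \<delta> \<epsilon> B \<longleftrightarrow>
     (\<forall>x xc xt C zh kc m t. rpb_run n f f' h x0 lam \<delta> x xc xt C zh kc m t \<longrightarrow>
        (\<exists>j k. k < kc j \<and> phi f h (zh k) - opt_value n (phi f h) \<le> ereal \<epsilon> \<and> real j \<le> B))"

definition rpb_rate :: "real \<Rightarrow> real \<Rightarrow> real \<Rightarrow> real \<Rightarrow> real" where
  "rpb_rate Mf \<mu> d \<epsilon> =
     min (Mf\<^sup>2 * d\<^sup>2 / \<epsilon>\<^sup>2)
         (if \<mu> = 0 then Mf\<^sup>2 * d\<^sup>2 / \<epsilon>\<^sup>2
          else (Mf\<^sup>2 / (\<mu> * \<epsilon>) + 1) * ln (\<mu> * d\<^sup>2 / \<epsilon> + 1))"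

end

theory Submission
  imports Defs
begin

text \<open>
  Write \<open>\<sigma> = \<mu> + 1/\<lambda>\<close>, let \<open>\<delta> = \<epsilon>/2\<close> be the tolerance of the method and fix a minimizer \<open>x\<^sub>*\<close> with
  \<open>\<parallel>x\<^sub>0 - x\<^sub>*\<parallel> \<le> 2 d\<^sub>0\<close>.  The iterations split into cycles, each consisting of null iterations with a common
  prox center followed by one serious iteration.  The number of cycles and the length of a cycle are
  bounded separately, and the claim is the product of the two bounds.

  Everything rests on one inequality (\<open>prox_model_growth\<close>): the proximal model is \<open>\<sigma>\<close>-strongly
  convex, so it grows quadratically away from its minimizer \<open>x\<^sub>j\<close>, and it does so even if all cuts
  that are inactive at \<open>x\<^sub>j\<close> are discarded, because near \<open>x\<^sub>j\<close> those cuts do not matter and growth of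
  a convex function is a local property.

  \<^emph>\<open>Cycles.\<close>  Growth at \<open>x\<^sub>*\<close> together with \<open>t\<^sub>j \<le> \<epsilon>/2\<close> shows (\<open>serious_step\<close>) that, as long as no
  \<open>\<epsilon>\<close>-solution has been found, the squared distance \<open>D\<^sup>2\<close> of the center to \<open>x\<^sub>*\<close> evolves as
  \<open>\<lambda>\<epsilon> + (1 + \<lambda>\<mu>) D\<^sub>n\<^sub>e\<^sub>w\<^sup>2 \<le> D\<^sub>o\<^sub>l\<^sub>d\<^sup>2\<close>.  Dropping \<open>\<mu>\<close> gives at most \<open>4 d\<^sub>0\<^sup>2/(\<lambda>\<epsilon>)\<close> cycles; adding \<open>\<epsilon>/\<mu>\<close> to both
  sides gives a geometric decrease of \<open>D\<^sup>2 + \<epsilon>/\<mu>\<close> by the factor \<open>1 + \<lambda>\<mu>\<close>, hence the logarithmic bound.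
  In particular the centers never move away from \<open>x\<^sub>*\<close>.

  \<^emph>\<open>Length of a cycle.\<close>  The gap \<open>t\<^sub>j\<^sub>+\<^sub>1\<close> is at most the model error at \<open>x\<^sub>j\<^sub>+\<^sub>1\<close>, and since the cut at
  \<open>x\<^sub>j\<close> belongs to the model this is at most \<open>2 M\<^sub>f \<parallel>x\<^sub>j\<^sub>+\<^sub>1 - x\<^sub>j\<parallel>\<close>; by growth, the optimal model value
  rises by \<open>\<sigma>/2 \<parallel>x\<^sub>j\<^sub>+\<^sub>1 - x\<^sub>j\<parallel>\<^sup>2\<close>.  So \<open>t\<^sub>j\<^sub>+\<^sub>1 + a t\<^sub>j\<^sub>+\<^sub>1\<^sup>2 \<le> t\<^sub>j\<close> with \<open>a = \<sigma>/(8 M\<^sub>f\<^sup>2)\<close>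
  (\<open>null_step\<close>), which forces a decay like \<open>1/(a p)\<close> in the number \<open>p\<close> of null iterations, provided
  that the first gap of the cycle is \<open>O(1/a)\<close>.  This last fact (\<open>first_model_error\<close>) is where the
  parameter restrictions enter: \<open>d\<^sub>0/M\<^sub>f \<le> \<lambda>\<close> and \<open>\<mu> \<le> C' M\<^sub>f/d\<^sub>0\<close> together say that \<open>d\<^sub>0 = O(M\<^sub>f/\<sigma>)\<close>, and
  then the first step of a cycle has length \<open>O(M\<^sub>f/\<sigma>)\<close> as well.  A cycle therefore has
  \<open>O(M\<^sub>f\<^sup>2/(\<sigma>\<epsilon>)) + 1\<close> iterations.

  In the product of the two bounds the terms that do not come from the leading factors are absorbed
  by means of \<open>d\<^sub>0/M\<^sub>f \<le> \<lambda> \<le> C d\<^sub>0\<^sup>2/\<epsilon>\<close> and \<open>C M\<^sub>f d\<^sub>0/\<epsilon> \<ge> 1\<close>.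
\<close>

section \<open>Euclidean geometry\<close>

lemma norm_n_power2: "(norm_n n x)\<^sup>2 = (\<Sum>i<n. (x i)\<^sup>2)"
  by (simp add: norm_n_def L2_set_def sum_nonneg)

lemma norm_n_nonneg [simp]: "0 \<le> norm_n n x"
  by (simp add: norm_n_def)

lemma norm_n_minus_commute: "norm_n n (x - y) = norm_n n (y - x)"
  by (simp add: norm_n_def L2_set_def power2_commute)

lemma norm_n_triangle: "norm_n n (x - z) \<le> norm_n n (x - y) + norm_n n (y - z)"
proof -
  have "x - z = (\<lambda>i. (x - y) i + (y - z) i)" by auto
  then show ?thesis
    unfolding norm_n_def by (metis L2_set_triangle_ineq)
qed

lemma abs_inner_n_le: "\<bar>inner_n n x y\<bar> \<le> norm_n n x * norm_n n y"
proof -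
  have "\<bar>inner_n n x y\<bar> \<le> (\<Sum>i<n. \<bar>x i\<bar> * \<bar>y i\<bar>)"
    unfolding inner_n_def abs_mult[symmetric] by (rule sum_abs)
  also have "\<dots> \<le> norm_n n x * norm_n n y"
    unfolding norm_n_def by (rule L2_set_mult_ineq)
  finally show ?thesis .
qed

lemma norm_n_comb:
  "(norm_n n (comb s u x - c))\<^sup>2 =
     s * (norm_n n (u - c))\<^sup>2 + (1 - s) * (norm_n n (x - c))\<^sup>2 - s * (1 - s) * (norm_n n (u - x))\<^sup>2"
  unfolding norm_n_power2 sum_distrib_left sum.distrib[symmetric] sum_subtractf[symmetric]
  by (rule sum.cong) (auto simp: comb_def power2_eq_square algebra_simps)

lemma inner_n_comb:
  "inner_n n v (comb s u x - y) = s * inner_n n v (u - y) + (1 - s) * inner_n n v (x - y)"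
  unfolding inner_n_def sum_distrib_left sum.distrib[symmetric]
  by (rule sum.cong) (auto simp: comb_def algebra_simps)

lemma comb_in_Rn: "z \<in> Rn n \<Longrightarrow> u \<in> Rn n \<Longrightarrow> comb s z u \<in> Rn n"
  by (simp add: topspace_Euclidean_space comb_def)

text \<open>
  Strong convexity along a segment (with total modulus \<open>q\<close>) turns minimality near one endpoint into
  growth up to the other: divide by \<open>s\<close> and let \<open>s\<close> tend to 0.  Asking only for local minimality
  is what allows inactive cuts to be discarded later.
\<close>

lemma quadratic_growth:
  assumes convex: "\<And>s. 0 < s \<Longrightarrow> s < 1 \<Longrightarrow>
      G (comb s u x) \<le> s * G u + (1 - s) * G x - s * (1 - s) * q"
    and local_min: "eventually (\<lambda>s. G x \<le> G (comb s u x)) (at_right (0::real))"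
  shows "G x + q \<le> (G u :: real)"
proof -
  have "eventually (\<lambda>s::real. s < 1) (at_right 0)"
    by (rule eventually_at_right_real[THEN eventually_mono, of 0 1]) auto
  with local_min eventually_at_right_less[of 0]
  have "eventually (\<lambda>s. (1 - s) * q \<le> G u - G x) (at_right (0::real))"
  proof eventually_elim
    case (elim s)
    from elim convex[of s] have "s * ((1 - s) * q) \<le> s * (G u - G x)"
      by (simp add: algebra_simps)
    with elim(2) show ?case by (simp add: mult_le_cancel_left_pos)
  qed
  moreover have "((\<lambda>s. (1 - s) * q) \<longlongrightarrow> (1 - 0) * q) (at_right (0::real))"
    by (intro tendsto_intros)
  ultimately have "(1 - 0) * q \<le> G u - G x"
    by (intro tendsto_upperbound) auto
  then show ?thesis by simp
qed

section \<open>Cutting-plane models on the domain of \<open>h\<close>\<close>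

context basic_assumptions
begin

abbreviation D :: "point set" where "D \<equiv> edom n h"

text \<open>
  On \<open>dom h\<close> all functions of the method are finite; the analysis is carried out with their real
  values.
\<close>

definition F :: "point \<Rightarrow> real" where "F u = real_of_ereal (f u)"

definition H :: "point \<Rightarrow> real" where "H u = real_of_ereal (h u)"

definition rcut :: "point \<Rightarrow> point \<Rightarrow> real" where
  "rcut y u = F y + inner_n n (f' y) (u - y)"

definition rmodel :: "point set \<Rightarrow> point \<Rightarrow> real" where
  "rmodel S u = Max ((\<lambda>y. rcut y u) ` S)"

text \<open>The summand \<open>h\<close> is built in: \<open>g\<close> stands for \<open>f\<close> or for one of its models.\<close>

definition rprox :: "real \<Rightarrow> point \<Rightarrow> (point \<Rightarrow> real) \<Rightarrow> point \<Rightarrow> real" where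
  "rprox lam c g u = g u + H u + (norm_n n (u - c))\<^sup>2 / (2 * lam)"

lemma D_Rn: "u \<in> D \<Longrightarrow> u \<in> Rn n"
  by (simp add: edom_def)

lemma f_eq: "u \<in> D \<Longrightarrow> f u = ereal (F u)"
  using dom f_fun(1) unfolding F_def proper_fun_def edom_def
  by (cases "f u") auto

lemma h_eq: "u \<in> D \<Longrightarrow> h u = ereal (H u)"
  using h_fun(1) unfolding H_def proper_fun_def edom_def
  by (cases "h u") auto

lemma phi_eq: "u \<in> D \<Longrightarrow> phi f h u = ereal (F u + H u)"
  by (simp add: phi_def f_eq h_eq)

lemma D_comb:
  assumes "z \<in> D" "u \<in> D" "0 \<le> s" "s \<le> 1"
  shows "comb s z u \<in> D"
proof -
  have "h (comb s z u) < \<infinity>"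
    using mu_convex[of z u s] assms(3,4)
    by (simp add: assms(1,2) h_eq[OF assms(1)] h_eq[OF assms(2)]) (metis ereal_infty_less_eq(1) not_less PInfty_neq_ereal(1))
  then show ?thesis
    using comb_in_Rn D_Rn assms(1,2) by (simp add: edom_def)
qed

lemma H_comb:
  assumes "z \<in> D" "u \<in> D" "0 \<le> s" "s \<le> 1"
  shows "H (comb s z u) \<le> s * H z + (1 - s) * H u - s * (1 - s) * \<mu> / 2 * (norm_n n (z - u))\<^sup>2"
  using mu_convex[of z u s] assms D_comb[OF assms] h_eq by simp

lemma rcut_le:
  assumes "y \<in> D" "u \<in> D" shows "rcut y u \<le> F u"
  using subgradient[OF assms(1)] D_Rn[OF assms(2)] f_eq assms
  unfolding subdiff_def rcut_def by force

text \<open>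
  The subgradient inequality at \<open>u\<close> bounds \<open>F u - F y\<close> from above by \<open>Mf\<close> times the distance, and
  the slope of the cut is bounded by \<open>Mf\<close> as well.
\<close>

lemma rcut_gap:
  assumes "y \<in> D" "u \<in> D" shows "F u - rcut y u \<le> 2 * Mf * norm_n n (u - y)"
proof -
  have bd: "\<bar>inner_n n (f' z) w\<bar> \<le> Mf * norm_n n w" if "z \<in> D" for z w
    using abs_inner_n_le[of n "f' z" w] mult_right_mono[OF subgradient_bound[OF that] norm_n_nonneg[of n w]]
    by linarith
  have "rcut u y \<le> F y" by (rule rcut_le) fact+
  then show ?thesis
    using bd[OF assms(1), of "u - y"] bd[OF assms(2), of "y - u"]
    by (simp add: rcut_def norm_n_minus_commute[of n y u])
qed

lemma rcut_comb: "rcut y (comb s u x) = s * rcut y u + (1 - s) * rcut y x"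
  unfolding rcut_def inner_n_comb by (simp add: algebra_simps)

lemma rcut_le_rmodel: "finite S \<Longrightarrow> y \<in> S \<Longrightarrow> rcut y u \<le> rmodel S u"
  by (simp add: rmodel_def)

lemma rmodel_le_iff: "finite S \<Longrightarrow> S \<noteq> {} \<Longrightarrow> rmodel S u \<le> a \<longleftrightarrow> (\<forall>y\<in>S. rcut y u \<le> a)"
  by (simp add: rmodel_def)

lemma rmodel_mono: "finite S \<Longrightarrow> T \<subseteq> S \<Longrightarrow> T \<noteq> {} \<Longrightarrow> rmodel T u \<le> rmodel S u"
  by (meson finite_subset rcut_le_rmodel rmodel_le_iff subsetD)

lemma rmodel_attained: "finite S \<Longrightarrow> S \<noteq> {} \<Longrightarrow> \<exists>y\<in>S. rcut y u = rmodel S u"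
proof -
  assume "finite S" "S \<noteq> {}"
  then have "rmodel S u \<in> (\<lambda>y. rcut y u) ` S"
    unfolding rmodel_def by (intro Max_in) auto
  then show ?thesis by auto
qed

lemma rmodel_le: "finite S \<Longrightarrow> S \<noteq> {} \<Longrightarrow> S \<subseteq> D \<Longrightarrow> u \<in> D \<Longrightarrow> rmodel S u \<le> F u"
  using rcut_le by (auto simp: rmodel_le_iff)

lemma rmodel_comb:
  assumes "finite S" "S \<noteq> {}" "0 \<le> s" "s \<le> 1"
  shows "rmodel S (comb s u x) \<le> s * rmodel S u + (1 - s) * rmodel S x"
  using assms by (auto simp: rmodel_le_iff rcut_comb intro!: add_mono mult_left_mono rcut_le_rmodel)

lemma cut_eq: "y \<in> D \<Longrightarrow> cut n f f' y u = ereal (rcut y u)"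
  by (simp add: cut_def rcut_def f_eq)

lemma model_eq:
  assumes "finite S" "S \<noteq> {}" "S \<subseteq> D"
  shows "model n f f' S u = ereal (rmodel S u)"
proof -
  have "(\<lambda>y. cut n f f' y u) ` S = ereal ` (\<lambda>y. rcut y u) ` S"
    using assms(3) cut_eq unfolding image_image by (intro image_cong) auto
  moreover have "ereal (Max ((\<lambda>y. rcut y u) ` S)) = Max (ereal ` (\<lambda>y. rcut y u) ` S)"
    using assms by (intro mono_Max_commute) (auto simp: mono_def)
  ultimately show ?thesis by (simp add: model_def rmodel_def)
qed

lemma rprox_comb:
  assumes "finite S" "S \<noteq> {}" "0 \<le> s" "s \<le> 1" "u \<in> D" "x \<in> D" "lam > 0"
  shows "rprox lam c (rmodel S) (comb s u x) \<le>
    s * rprox lam c (rmodel S) u + (1 - s) * rprox lam c (rmodel S) x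
      - s * (1 - s) * ((\<mu> + 1 / lam) / 2 * (norm_n n (u - x))\<^sup>2)"
proof -
  define w where "w = 1 / (2 * lam)"
  have w: "a / (2 * lam) = a * w" "1 / lam = 2 * w" for a
    using assms(7) by (simp_all add: w_def)
  show ?thesis
    using rmodel_comb[OF assms(1-4), of u x] H_comb[OF assms(5,6,3,4)]
    unfolding rprox_def norm_n_comb w
    by (simp add: algebra_simps add_divide_distrib diff_divide_distrib)
qed

text \<open>
  At points \<open>comb s u x\<close> with small \<open>s\<close>, every cut that is inactive at \<open>x\<close> still lies below some
  active one, so \<open>x\<close> is a local minimizer along the segment for the model that keeps the active cuts
  only.  The bundle of the next iteration contains these cuts.
\<close>

lemma prox_model_growth:
  assumes S: "finite S" "S \<noteq> {}" and lam: "lam > 0" and xu: "x \<in> D" "u \<in> D"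
    and min: "\<And>w. w \<in> D \<Longrightarrow> rprox lam c (rmodel S) x \<le> rprox lam c (rmodel S) w"
    and T: "finite T" "{y \<in> S. rcut y x = rmodel S x} \<subseteq> T"
  shows "rprox lam c (rmodel S) x + (\<mu> + 1 / lam) / 2 * (norm_n n (u - x))\<^sup>2
    \<le> rprox lam c (rmodel T) u"
proof -
  define A where "A = {y \<in> S. rcut y x = rmodel S x}"
  obtain a where a: "a \<in> A"
    using rmodel_attained[OF S] unfolding A_def by blast
  have A: "finite A" "A \<noteq> {}" "A \<subseteq> S"
    using S a by (auto simp: A_def)
  have Ax: "rmodel A x = rmodel S x"
  proof (rule antisym)
    show "rmodel A x \<le> rmodel S x" using S A by (intro rmodel_mono)
    show "rmodel S x \<le> rmodel A x" using rcut_le_rmodel[OF A(1) a, of x] a by (simp add: A_def)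
  qed
  \<comment> \<open>Finitely many cuts, so it suffices to compare each of them with the active cut at \<open>a\<close>.\<close>
  have "eventually (\<lambda>s. \<forall>y\<in>S. rcut y (comb s u x) \<le> rmodel A (comb s u x)) (at_right 0)"
    unfolding eventually_ball_finite_distrib[OF S(1)]
  proof
    fix y assume y: "y \<in> S"
    show "eventually (\<lambda>s. rcut y (comb s u x) \<le> rmodel A (comb s u x)) (at_right 0)"
    proof (cases "y \<in> A")
      case True
      then show ?thesis using rcut_le_rmodel[OF A(1)] by simp
    next
      case False
      then have "rcut y x < rcut a x"
        using y a rcut_le_rmodel[OF S(1) y, of x] by (auto simp: A_def)
      moreover have "((\<lambda>s. rcut a (comb s u x) - rcut y (comb s u x)) \<longlongrightarrow>
          (0 * rcut a u + (1 - 0) * rcut a x) - (0 * rcut y u + (1 - 0) * rcut y x)) (at_right 0)"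
        unfolding rcut_comb by (intro tendsto_intros)
      ultimately have "eventually (\<lambda>s. 0 < rcut a (comb s u x) - rcut y (comb s u x)) (at_right 0)"
        by (intro order_tendstoD(1)) auto
      then show ?thesis
      proof eventually_elim
        case (elim s)
        then show ?case using rcut_le_rmodel[OF A(1) a, of "comb s u x"] by linarith
      qed
    qed
  qed
  moreover have "eventually (\<lambda>s::real. 0 < s \<and> s < 1) (at_right 0)"
    by (rule eventually_at_right_real[THEN eventually_mono, of 0 1]) auto
  ultimately have "eventually (\<lambda>s. rprox lam c (rmodel A) x \<le> rprox lam c (rmodel A) (comb s u x))
      (at_right 0)"
  proof eventually_elim
    case (elim s)
    have "rmodel S (comb s u x) \<le> rmodel A (comb s u x)"
      using elim(1) S by (simp add: rmodel_le_iff)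
    then show ?case
      using min[OF D_comb[OF xu(2,1), of s]] elim(2) by (simp add: rprox_def Ax)
  qed
  then have "rprox lam c (rmodel A) x + (\<mu> + 1 / lam) / 2 * (norm_n n (u - x))\<^sup>2
      \<le> rprox lam c (rmodel A) u"
    using rprox_comb[OF A(1,2) _ _ xu(2,1) lam]
    by (intro quadratic_growth) auto
  then show ?thesis
    using rmodel_mono[of T A u] A T Ax by (simp add: rprox_def A_def[symmetric])
qed

lemma model_error:
  assumes "finite S" "S \<subseteq> D" "y \<in> S" "x \<in> D"
  shows "F x - rmodel S x \<le> 2 * Mf * norm_n n (x - y)"
  using rcut_gap[of y x] rcut_le_rmodel[of S y x] assms by auto

text \<open>
  The first step of a cycle may be long when \<open>h\<close> decreases steeply; the minimizer \<open>xs\<close>, which is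
  not far from the center, serves as an anchor.  Growth at \<open>xs\<close> bounds \<open>e = \<parallel>xs - x\<parallel>\<close> by a quadratic inequality whose linear term is
  the model error \<open>2 Mf (e + d)\<close>; measured in units of \<open>Mf/\<sigma>\<close> it reads
  \<open>E\<^sup>2/2 \<le> 2 (E + K) + K\<^sup>2/2\<close>, hence \<open>E \<le> 4 + K\<close>.
\<close>

lemma first_model_error:
  assumes S: "finite S" "S \<subseteq> D" "c \<in> S" and lam: "lam > 0" and x: "x \<in> D"
    and min: "\<And>w. w \<in> D \<Longrightarrow> rprox lam c (rmodel S) x \<le> rprox lam c (rmodel S) w"
    and xs: "xs \<in> D" "\<And>w. w \<in> D \<Longrightarrow> F xs + H xs \<le> F w + H w"
    and Mf: "Mf > 0" and \<kappa>: "\<kappa> \<ge> 0" "norm_n n (xs - c) \<le> \<kappa> * Mf / (\<mu> + 1 / lam)"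
  shows "F x - rmodel S x \<le> (8 + 4 * \<kappa>) * Mf\<^sup>2 / (\<mu> + 1 / lam)"
proof -
  define \<sigma> where "\<sigma> = \<mu> + 1 / lam"
  have \<sigma>: "\<sigma> > 0" "1 / lam \<le> \<sigma>"
    using params(3) lam by (simp_all add: \<sigma>_def add_nonneg_pos)
  define d r e where "d = norm_n n (xs - c)" and "r = norm_n n (x - c)" and "e = norm_n n (xs - x)"
  have r: "r \<le> e + d"
    using norm_n_triangle[of n x c xs] by (simp add: r_def e_def d_def norm_n_minus_commute[of n x xs])
  have nonneg: "d \<ge> 0" "e \<ge> 0" "r \<ge> 0" by (simp_all add: d_def e_def r_def)
  have S0: "S \<noteq> {}" using S by auto
  have err: "F x - rmodel S x \<le> 2 * Mf * r"
    unfolding r_def by (rule model_error[OF S x])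
  have "rprox lam c (rmodel S) x + \<sigma> / 2 * e\<^sup>2 \<le> rprox lam c (rmodel S) xs"
    unfolding \<sigma>_def e_def using S S0 lam x xs min by (intro prox_model_growth) auto
  also have "\<dots> \<le> F xs + H xs + d\<^sup>2 / (2 * lam)"
    using rmodel_le[OF S(1) S0 S(2) xs(1)] by (simp add: rprox_def d_def)
  finally have "rmodel S x + H x + r\<^sup>2 / (2 * lam) + \<sigma> / 2 * e\<^sup>2 \<le> F x + H x + d\<^sup>2 / (2 * lam)"
    using xs(2)[OF x] by (simp add: rprox_def r_def)
  moreover have "r\<^sup>2 / (2 * lam) \<ge> 0" using lam by simp
  moreover have "d\<^sup>2 / (2 * lam) \<le> \<sigma> / 2 * d\<^sup>2"
    using mult_right_mono[OF \<sigma>(2), of "d\<^sup>2 / 2"] by simp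
  moreover have "2 * Mf * r \<le> 2 * Mf * (e + d)" using r Mf by simp
  ultimately have main: "\<sigma> / 2 * e\<^sup>2 \<le> 2 * Mf * (e + d) + \<sigma> / 2 * d\<^sup>2"
    using err by linarith
  define E K where "E = \<sigma> * e / Mf" and "K = \<sigma> * d / Mf"
  have e: "e = E * Mf / \<sigma>" and d: "d = K * Mf / \<sigma>"
    using \<sigma> Mf by (simp_all add: E_def K_def)
  have K: "0 \<le> K" "K \<le> \<kappa>"
    using \<kappa>(2) \<sigma>(1) Mf nonneg unfolding K_def d_def[symmetric] \<sigma>_def[symmetric]
    by (simp_all add: field_simps)
  have "(E\<^sup>2 / 2) * (Mf\<^sup>2 / \<sigma>) \<le> (2 * (E + K) + K\<^sup>2 / 2) * (Mf\<^sup>2 / \<sigma>)"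
    using main \<sigma> unfolding e d by (simp add: power2_eq_square field_simps)
  then have EK: "E\<^sup>2 / 2 \<le> 2 * (E + K) + K\<^sup>2 / 2"
    using \<sigma> Mf by (subst (asm) mult_le_cancel_right_pos) auto
  have "E \<le> 4 + K"
  proof (rule ccontr)
    assume "\<not> E \<le> 4 + K"
    then have "0 < E + K" "0 < E - K - 4" using K by auto
    then have "0 < (E + K) * (E - K - 4)" by (rule mult_pos_pos)
    with EK show False by (simp add: power2_eq_square algebra_simps)
  qed
  then have "E + K \<le> 4 + 2 * \<kappa>" using K by simp
  then have "(E + K) * (2 * Mf\<^sup>2 / \<sigma>) \<le> (4 + 2 * \<kappa>) * (2 * Mf\<^sup>2 / \<sigma>)"
    using \<sigma> by (intro mult_right_mono) auto
  moreover have "2 * Mf * (e + d) = (E + K) * (2 * Mf\<^sup>2 / \<sigma>)"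
    unfolding e d by (simp add: power2_eq_square algebra_simps add_divide_distrib)
  moreover have "2 * Mf * r \<le> 2 * Mf * (e + d)" using r Mf by simp
  ultimately show ?thesis
    using err unfolding \<sigma>_def[symmetric] by (simp add: algebra_simps add_divide_distrib)
qed

end

text \<open>
  With \<open>b = \<beta>/(a (p + 1))\<close>, monotonicity of \<open>g' \<mapsto> g' + a g'\<^sup>2\<close> reduces the claim to
  \<open>b + a b\<^sup>2 \<ge> \<beta>/(a p)\<close>, i.e. to \<open>\<beta> p \<ge> p + 1\<close>; this is why \<open>\<beta> \<ge> 2\<close> is required.
\<close>

lemma gap_recursion_rate:
  fixes a \<beta> g g' p :: real
  assumes "a > 0" "\<beta> \<ge> 2" "p \<ge> 1" "g \<le> \<beta> / (a * p)" "g' + a * g'\<^sup>2 \<le> g"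
  shows "g' \<le> \<beta> / (a * (p + 1))"
proof (rule ccontr)
  assume neg: "\<not> g' \<le> \<beta> / (a * (p + 1))"
  define b where "b = \<beta> / (a * (p + 1))"
  have ab: "a * b = \<beta> / (p + 1)" and b: "b > 0" using assms by (simp_all add: b_def)
  have "b < g'" using neg by (simp add: b_def)
  moreover have "b\<^sup>2 < g'\<^sup>2" using \<open>b < g'\<close> b by (simp add: power_strict_mono)
  ultimately have "b + a * b\<^sup>2 < g' + a * g'\<^sup>2" using assms(1) by (intro add_strict_mono) auto
  then have "b + a * b\<^sup>2 < \<beta> / (a * p)" using assms by linarith
  then have "a * p * (b + a * b\<^sup>2) < \<beta>" using assms by (simp add: field_simps)
  also have "a * p * (b + a * b\<^sup>2) = p * (a * b) * (1 + a * b)"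
    by (simp add: power2_eq_square algebra_simps)
  finally have lt: "p * (\<beta> / (p + 1)) * (1 + \<beta> / (p + 1)) < \<beta>" unfolding ab .
  then have "\<beta> * (p * (p + 1 + \<beta>)) < \<beta> * (p + 1)\<^sup>2"
  proof -
    have "p * (\<beta> / (p + 1)) * (1 + \<beta> / (p + 1)) = \<beta> * (p * (p + 1 + \<beta>)) / (p + 1)\<^sup>2"
      using assms(3) by (simp add: power2_eq_square add_divide_eq_iff)
    with lt have "\<beta> * (p * (p + 1 + \<beta>)) / (p + 1)\<^sup>2 < \<beta>" by linarith
    moreover have "(p + 1)\<^sup>2 > 0" using assms(3) by simp
    ultimately show ?thesis by (simp only: pos_divide_less_eq)
  qed
  then have "p * (p + 1 + \<beta>) < (p + 1)\<^sup>2" using assms(2) by (simp add: mult_less_cancel_left)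
  moreover have "p * 2 \<le> p * \<beta>" using assms by (intro mult_left_mono) auto
  moreover have "(p + 1)\<^sup>2 = p * (p + 1) + p + 1" by (simp add: power2_eq_square algebra_simps)
  ultimately show False using assms(3) unfolding distrib_left[of p "p + 1" \<beta>] by linarith
qed

section \<open>Executions of the method\<close>

locale rpb_analysis =
  basic_assumptions n f f' h Mf Mh \<mu> + rpb_run n f f' h x0 lam \<delta> x xc xt C zh kc m t
  for n f f' h Mf Mh \<mu> x0 lam \<delta> x xc xt C zh kc m t +
  fixes xs :: point
  assumes pos: "Mf > 0" "lam > 0" "\<delta> > 0"
    and x0_D: "x0 \<in> D"
    and xs_minimizer: "xs \<in> minimizers n (phi f h)"
begin

lemma xs_le: "u \<in> Rn n \<Longrightarrow> phi f h xs \<le> phi f h u"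
  using xs_minimizer by (auto simp: minimizers_def is_arg_min_def not_less)

lemma xs_D: "xs \<in> D"
proof -
  have xs: "xs \<in> Rn n" using xs_minimizer by (simp add: minimizers_def is_arg_min_def)
  then have "f xs \<noteq> -\<infinity>" using f_fun(1) by (simp add: proper_fun_def)
  moreover have "f xs + h xs \<le> ereal (F x0 + H x0)"
    using xs_le[OF D_Rn[OF x0_D]] phi_eq[OF x0_D] by (simp add: phi_def)
  ultimately show ?thesis
    using xs by (cases "f xs"; cases "h xs") (auto simp: edom_def)
qed

lemma xs_min: "u \<in> D \<Longrightarrow> F xs + H xs \<le> F u + H u"
  using xs_le[of u] D_Rn[of u] phi_eq[OF xs_D] phi_eq[of u] by simp

lemma opt_value_eq: "opt_value n (phi f h) = ereal (F xs + H xs)"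
  unfolding opt_value_def phi_eq[OF xs_D, symmetric]
  by (rule antisym) (auto intro!: INF_lower INF_greatest xs_le D_Rn[OF xs_D])

text \<open>
  The subproblem value at \<open>x0\<close> is finite, so each \<open>x j\<close> stays in \<open>dom h\<close>.  The claim for \<open>x\<close> has to
  cover all earlier indices because a serious iteration may return to any of them.
\<close>

lemma iterates:
  "(\<forall>i\<le>j. x i \<in> D) \<and> xt j \<in> D \<and> xc j \<in> D \<and> finite (C (Suc j)) \<and> x j \<in> C (Suc j) \<and> C (Suc j) \<subseteq> D"
proof (induction j)
  case 0
  then show ?case using init x0_D by simp
next
  case (Suc j)
  have C: "finite (C (Suc j))" "C (Suc j) \<noteq> {}" "C (Suc j) \<subseteq> D" using Suc by auto
  have arg: "is_arg_min (prox n lam (xc j) (\<lambda>u. model n f f' (C (Suc j)) u + h u)) (\<lambda>u. u \<in> Rn n) (x (Suc j))"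
    using subproblem[of "Suc j"] by simp
  have "prox n lam (xc j) (\<lambda>u. model n f f' (C (Suc j)) u + h u) (x (Suc j))
      \<le> prox n lam (xc j) (\<lambda>u. model n f f' (C (Suc j)) u + h u) x0"
    using arg D_Rn[OF x0_D] by (auto simp: is_arg_min_def not_less)
  then have "h (x (Suc j)) < \<infinity>"
    by (cases "h (x (Suc j))") (auto simp: prox_def model_eq[OF C] h_eq[OF x0_D])
  moreover have "x (Suc j) \<in> Rn n" using arg by (simp add: is_arg_min_def)
  ultimately have x: "x (Suc j) \<in> D" by (simp add: edom_def)
  have xi: "\<forall>i\<le>Suc j. x i \<in> D" using x Suc by (auto simp: le_Suc_eq)
  have xt: "xt (Suc j) \<in> D"
    using xt_choice[of "Suc j"] x Suc by (auto simp: is_arg_min_def)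
  show ?case
  proof (cases "t (Suc j) \<le> ereal \<delta>")
    case True
    then show ?thesis using serious[of "Suc j"] xi xt x by (auto simp: subset_iff)
  next
    case False
    then show ?thesis using null[of "Suc j"] xi xt x Suc by (auto intro: finite_subset)
  qed
qed

lemma x_D: "x j \<in> D" and xt_D: "xt j \<in> D" and xc_D: "xc j \<in> D"
  and C_finite: "finite (C (Suc j))" and x_in_C: "x j \<in> C (Suc j)" and C_D: "C (Suc j) \<subseteq> D"
  using iterates[of j] by auto

lemma C_nonempty: "C (Suc j) \<noteq> {}" using x_in_C by auto

text \<open>
  The real values of \<open>m (Suc j)\<close> and \<open>t (Suc j)\<close>, indexed by the iteration before because its center
  \<open>xc j\<close> is the one they refer to.
\<close>

definition v :: "nat \<Rightarrow> real" where
  "v j = rprox lam (xc j) (rmodel (C (Suc j))) (x (Suc j))"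

definition gap :: "nat \<Rightarrow> real" where
  "gap j = rprox lam (xc j) F (xt (Suc j)) - v j"

lemma prox_model_eq:
  "u \<in> D \<Longrightarrow> prox n lam c (\<lambda>u. model n f f' (C (Suc j)) u + h u) u
     = ereal (rprox lam c (rmodel (C (Suc j))) u)"
  by (simp add: prox_def rprox_def h_eq model_eq[OF C_finite C_nonempty C_D])

lemma prox_phi_eq: "u \<in> D \<Longrightarrow> prox n lam c (phi f h) u = ereal (rprox lam c F u)"
  by (simp add: prox_def rprox_def phi_eq)

lemma v_min: "w \<in> D \<Longrightarrow> v j \<le> rprox lam (xc j) (rmodel (C (Suc j))) w"
  using subproblem[of "Suc j"] D_Rn[of w] prox_model_eq[of w "xc j" j] prox_model_eq[OF x_D, of "xc j" j "Suc j"]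
  by (auto simp: is_arg_min_def not_less v_def)

lemma t_gap: "t (Suc j) = ereal (gap j)"
  using t_eq[of "Suc j"] m_eq[of "Suc j"] prox_phi_eq[OF xt_D, of "xc j" "Suc j"]
    prox_model_eq[OF x_D, of "xc j" j "Suc j"]
  by (simp add: gap_def v_def)

lemma xt_le: 
  "rprox lam (xc j) F (xt (Suc j)) \<le> rprox lam (xc j) F (x (Suc j))"
  "rprox lam (xc j) F (xt (Suc j)) \<le> rprox lam (xc j) F (xt j)"
  using xt_choice[of "Suc j"] prox_phi_eq[OF xt_D, of "xc j" "Suc j"] prox_phi_eq[OF xt_D, of "xc j" "j"]
    prox_phi_eq[OF x_D, of "xc j" "Suc j"]
  by (auto simp: is_arg_min_def not_less)

lemma gap_le_model_error: "gap j \<le> F (x (Suc j)) - rmodel (C (Suc j)) (x (Suc j))"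
  using xt_le(1)[of j] by (simp add: gap_def v_def rprox_def)

definition \<sigma> :: real where "\<sigma> = \<mu> + 1 / lam"

lemma \<sigma>_pos: "\<sigma> > 0"
  using params(3) pos by (simp add: \<sigma>_def add_nonneg_pos)

lemma v_growth:
  assumes "u \<in> D" "finite T" "{y \<in> C (Suc j). rcut y (x (Suc j)) = rmodel (C (Suc j)) (x (Suc j))} \<subseteq> T"
  shows "v j + \<sigma> / 2 * (norm_n n (u - x (Suc j)))\<^sup>2 \<le> rprox lam (xc j) (rmodel T) u"
  unfolding v_def \<sigma>_def using assms C_finite C_nonempty pos x_D v_min[of _ j]
  by (intro prox_model_growth) (auto simp: v_def)

text \<open>
  With \<open>r\<close> the distance of consecutive iterates, the optimal model value rises by at least
  \<open>\<sigma> r\<^sup>2/2\<close> while the prox center and hence the upper value do not get worse; on the other hand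
  the new gap is at most \<open>2 Mf r\<close>.  Eliminating \<open>r\<close> gives the recursion.
\<close>

lemma null_step:
  assumes null_j: "gap j > \<delta>" and nonneg: "gap (Suc j) \<ge> 0"
  shows "gap (Suc j) + \<sigma> / (8 * Mf\<^sup>2) * (gap (Suc j))\<^sup>2 \<le> gap j"
proof -
  define r where "r = norm_n n (x (Suc (Suc j)) - x (Suc j))"
  have nl: "{y \<in> C (Suc j). cut n f f' y (x (Suc j)) = model n f f' (C (Suc j)) (x (Suc j))}
      \<subseteq> C (Suc (Suc j))" "xc (Suc j) = xc j"
    using null[of "Suc j"] null_j by (auto simp: t_gap)
  have "v j + \<sigma> / 2 * r\<^sup>2 \<le> v (Suc j)"
    unfolding v_def[of "Suc j"] nl(2) r_def
  proof (rule v_growth[OF x_D C_finite])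
    show "{y \<in> C (Suc j). rcut y (x (Suc j)) = rmodel (C (Suc j)) (x (Suc j))} \<subseteq> C (Suc (Suc j))"
      using nl(1) C_D[of j] by (auto simp: model_eq[OF C_finite C_nonempty C_D] cut_eq subset_iff)
  qed
  then have "gap (Suc j) \<le> gap j - \<sigma> / 2 * r\<^sup>2"
    using xt_le(2)[of "Suc j"] by (simp add: gap_def nl(2))
  moreover have "gap (Suc j) \<le> 2 * Mf * r"
    unfolding r_def
    by (rule order_trans[OF gap_le_model_error model_error]) (rule C_finite C_D x_in_C x_D)+
  then have "(gap (Suc j))\<^sup>2 \<le> (2 * Mf * r)\<^sup>2" using nonneg by (intro power_mono) auto
  then have "\<sigma> / (8 * Mf\<^sup>2) * (gap (Suc j))\<^sup>2 \<le> \<sigma> / (8 * Mf\<^sup>2) * (2 * Mf * r)\<^sup>2"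
    using \<sigma>_pos by (intro mult_left_mono) auto
  moreover have "\<sigma> / (8 * Mf\<^sup>2) * (2 * Mf * r)\<^sup>2 = \<sigma> / 2 * r\<^sup>2"
    using pos by (simp add: power2_eq_square)
  ultimately show ?thesis by linarith
qed

text \<open>
  Growth at the minimizer: half of the suboptimality \<open>2 \<delta>\<close> pays for the error \<open>\<delta>\<close> of the serious
  iteration, the other half is gained.
\<close>

lemma serious_step:
  assumes "gap j \<le> \<delta>" and not_opt: "F (xt (Suc j)) + H (xt (Suc j)) > F xs + H xs + 2 * \<delta>"
  shows "2 * lam * \<delta> + (1 + lam * \<mu>) * (norm_n n (xs - x (Suc j)))\<^sup>2 \<le> (norm_n n (xs - xc j))\<^sup>2"
proof -
  have "v j + \<sigma> / 2 * (norm_n n (xs - x (Suc j)))\<^sup>2 \<le> rprox lam (xc j) (rmodel (C (Suc j))) xs"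
    by (rule v_growth[OF xs_D C_finite]) auto
  also have "\<dots> \<le> F xs + H xs + (norm_n n (xs - xc j))\<^sup>2 / (2 * lam)"
    using rmodel_le[OF C_finite C_nonempty C_D xs_D] by (simp add: rprox_def)
  finally have "v j + \<sigma> / 2 * (norm_n n (xs - x (Suc j)))\<^sup>2 \<le>
      F xs + H xs + (norm_n n (xs - xc j))\<^sup>2 / (2 * lam)" .
  moreover have "F (xt (Suc j)) + H (xt (Suc j)) \<le> v j + \<delta>"
  proof -
    have "0 \<le> (norm_n n (xt (Suc j) - xc j))\<^sup>2 / (2 * lam)" using pos by simp
    then show ?thesis using assms(1) by (simp add: gap_def rprox_def)
  qed
  ultimately have "\<delta> + \<sigma> / 2 * (norm_n n (xs - x (Suc j)))\<^sup>2 \<le> (norm_n n (xs - xc j))\<^sup>2 / (2 * lam)"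
    using not_opt by linarith
  then have "(2 * lam) * (\<delta> + \<sigma> / 2 * (norm_n n (xs - x (Suc j)))\<^sup>2)
      \<le> (2 * lam) * ((norm_n n (xs - xc j))\<^sup>2 / (2 * lam))"
    using pos by (intro mult_left_mono) auto
  then show ?thesis
    using pos by (simp add: \<sigma>_def algebra_simps add_divide_distrib)
qed

lemma first_gap:
  assumes "\<kappa> \<ge> 0" "norm_n n (xs - x j) \<le> \<kappa> * Mf / \<sigma>" "xc j = x j"
  shows "gap j \<le> (8 + 4 * \<kappa>) * Mf\<^sup>2 / \<sigma>"
proof -
  have "F (x (Suc j)) - rmodel (C (Suc j)) (x (Suc j)) \<le> (8 + 4 * \<kappa>) * Mf\<^sup>2 / (\<mu> + 1 / lam)"
  proof (rule first_model_error[OF C_finite C_D x_in_C pos(2) x_D _ xs_D xs_min pos(1) assms(1)])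
    show "rprox lam (x j) (rmodel (C (Suc j))) (x (Suc j)) \<le> rprox lam (x j) (rmodel (C (Suc j))) w"
      if "w \<in> D" for w
      using v_min[OF that, of j] by (simp add: v_def assms(3))
    show "norm_n n (xs - x j) \<le> \<kappa> * Mf / (\<mu> + 1 / lam)"
      using assms(2) by (simp add: \<sigma>_def)
  qed
  with gap_le_model_error[of j] show ?thesis by (simp add: \<sigma>_def)
qed

lemma kc_mono: "i \<le> j \<Longrightarrow> kc i \<le> kc j"
proof (induction j rule: dec_induct)
  case (step j)
  then show ?case using serious[of "Suc j"] null[of "Suc j"] by (cases "t (Suc j) \<le> ereal \<delta>") auto
qed simp

text \<open>The point \<open>xt (Suc j)\<close> competes for \<open>zh (kc j)\<close>, which is available after iteration \<open>J\<close>.\<close>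

lemma serious_not_optimal:
  assumes "gap j \<le> \<delta>" "Suc j \<le> J"
    and none: "\<And>k. k < kc J \<Longrightarrow> \<not> phi f h (zh k) - opt_value n (phi f h) \<le> ereal (2 * \<delta>)"
  shows "F (xt (Suc j)) + H (xt (Suc j)) > F xs + H xs + 2 * \<delta>"
proof -
  have s: "is_arg_min (phi f h) (\<lambda>u. u \<in> {zh (kc j - 1), xt (Suc j)}) (zh (kc j))" "kc (Suc j) = kc j + 1"
    using serious[of "Suc j"] assms(1) by (auto simp: t_gap)
  have "phi f h (zh (kc j)) \<le> phi f h (xt (Suc j))"
    using s(1) by (auto simp: is_arg_min_def not_less)
  moreover have "kc j < kc J" using kc_mono[OF assms(2)] s(2) by simp
  then have "\<not> phi f h (zh (kc j)) - opt_value n (phi f h) \<le> ereal (2 * \<delta>)" by (rule none)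
  ultimately show ?thesis
    unfolding opt_value_eq phi_eq[OF xt_D]
    by (cases "phi f h (zh (kc j))") auto
qed

text \<open>
  The invariant of an execution that has not yet found a solution.  Here \<open>s\<close> counts the serious
  iterations so far, \<open>p\<close> the null iterations of the current cycle, and \<open>L\<close> bounds \<open>p\<close>: after \<open>p\<close> null
  iterations the gap is at most \<open>\<beta>/(a p)\<close> but still exceeds \<open>\<delta>\<close>.  The two inequalities for the distance
  to \<open>xs\<close> are the summed and the geometric form of \<open>serious_step\<close>; the second one is multiplied by \<open>\<mu>\<close>
  so that it is meaningful for \<open>\<mu> = 0\<close>.  The constant \<open>\<beta> = 2 + \<kappa>/2\<close> satisfies \<open>\<beta> \<ge> 2\<close> and
  covers the first gap of a cycle, for which \<open>a t \<le> 1 + \<kappa>/2\<close>.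
\<close>

lemma progress:
  fixes \<kappa> :: real and L :: real
  assumes \<kappa>: "\<kappa> \<ge> 0" "norm_n n (xs - x0) \<le> \<kappa> * Mf / \<sigma>"
    and none: "\<And>k. k < kc J \<Longrightarrow> \<not> phi f h (zh k) - opt_value n (phi f h) \<le> ereal (2 * \<delta>)"
    and L_def: "L = (2 + \<kappa> / 2) * (8 * Mf\<^sup>2) / (\<sigma> * \<delta>)"
    and "j \<le> J"
  shows "\<exists>s p :: nat.
    real s * (2 * lam * \<delta>) + (norm_n n (xs - xc j))\<^sup>2 \<le> (norm_n n (xs - x0))\<^sup>2 \<and>
    (1 + lam * \<mu>) ^ s * (\<mu> * (norm_n n (xs - xc j))\<^sup>2 + 2 * \<delta>)
      \<le> \<mu> * (norm_n n (xs - x0))\<^sup>2 + 2 * \<delta> \<and>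
    real j \<le> real s * (L + 1) + real p \<and> real p \<le> L \<and>
    (p = 0 \<and> xc j = x j \<or>
     (\<exists>i. j = Suc i \<and> p \<ge> 1 \<and> gap i > \<delta> \<and>
        gap i \<le> (2 + \<kappa> / 2) / (\<sigma> / (8 * Mf\<^sup>2) * real p)))"
  using \<open>j \<le> J\<close>
proof (induction j)
  case 0
  have "L \<ge> 0" using L_def \<kappa>(1) \<sigma>_pos pos by simp
  then show ?case using init by (intro exI[of _ 0]) auto
next
  case (Suc j)
  define a \<beta> where "a = \<sigma> / (8 * Mf\<^sup>2)" and "\<beta> = 2 + \<kappa> / 2"
  have a: "a > 0" and \<beta>: "\<beta> \<ge> 2" using \<sigma>_pos pos \<kappa>(1) by (simp_all add: a_def \<beta>_def)
  have L: "L = \<beta> / (a * \<delta>)" by (simp add: L_def a_def \<beta>_def)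
  obtain s p :: nat where IH:
    "real s * (2 * lam * \<delta>) + (norm_n n (xs - xc j))\<^sup>2 \<le> (norm_n n (xs - x0))\<^sup>2"
    "(1 + lam * \<mu>) ^ s * (\<mu> * (norm_n n (xs - xc j))\<^sup>2 + 2 * \<delta>)
      \<le> \<mu> * (norm_n n (xs - x0))\<^sup>2 + 2 * \<delta>"
    "real j \<le> real s * (L + 1) + real p" "real p \<le> L"
    "p = 0 \<and> xc j = x j \<or> (\<exists>i. j = Suc i \<and> p \<ge> 1 \<and> gap i > \<delta> \<and> gap i \<le> \<beta> / (a * real p))"
    using Suc unfolding a_def \<beta>_def by (metis Suc_leD)
  show ?case
  proof (cases "gap j \<le> \<delta>")
    case True
    have xc: "xc (Suc j) = x (Suc j)" using serious[of "Suc j"] True by (simp add: t_gap)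
    define d d' where "d = (norm_n n (xs - xc j))\<^sup>2" and "d' = (norm_n n (xs - x (Suc j)))\<^sup>2"
    have step: "2 * lam * \<delta> + (1 + lam * \<mu>) * d' \<le> d"
      using serious_step[OF True serious_not_optimal[OF True Suc.prems none]] by (simp add: d_def d'_def)
    have lm: "lam * \<mu> \<ge> 0" using pos params(3) by simp
    have "d' \<ge> 0" by (simp add: d'_def)
    then have "d' \<le> (1 + lam * \<mu>) * d'" using lm by (simp add: mult_le_cancel_right1)
    then have "real (Suc s) * (2 * lam * \<delta>) + d' \<le> (norm_n n (xs - x0))\<^sup>2"
      using IH(1) step by (simp add: d_def[symmetric] algebra_simps)
    moreover have "(1 + lam * \<mu>) ^ Suc s * (\<mu> * d' + 2 * \<delta>) \<le> \<mu> * (norm_n n (xs - x0))\<^sup>2 + 2 * \<delta>"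
    proof -
      have "\<mu> * (2 * lam * \<delta> + (1 + lam * \<mu>) * d') \<le> \<mu> * d"
        using step params(3) by (rule mult_left_mono)
      then have "(1 + lam * \<mu>) * (\<mu> * d' + 2 * \<delta>) \<le> \<mu> * d + 2 * \<delta>"
        by (simp add: algebra_simps)
      then have "(1 + lam * \<mu>) ^ s * ((1 + lam * \<mu>) * (\<mu> * d' + 2 * \<delta>))
          \<le> (1 + lam * \<mu>) ^ s * (\<mu> * d + 2 * \<delta>)"
        using lm by (intro mult_left_mono) auto
      then show ?thesis using IH(2) by (simp add: d_def[symmetric] mult.assoc mult.left_commute)
    qed
    moreover have "real (Suc j) \<le> real (Suc s) * (L + 1) + real 0"
      using IH(3,4) by (simp add: algebra_simps)
    moreover have "real 0 \<le> L" using IH(4) by simp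
    ultimately show ?thesis
      unfolding xc d'_def by blast
  next
    case False
    have xc: "xc (Suc j) = xc j" using null[of "Suc j"] False by (simp add: t_gap)
    have gap: "gap j \<le> \<beta> / (a * real (Suc p))"
    proof (cases "p = 0 \<and> xc j = x j")
      case True
      have "0 \<le> real s * (2 * lam * \<delta>)" using pos by simp
      then have "(norm_n n (xs - xc j))\<^sup>2 \<le> (norm_n n (xs - x0))\<^sup>2"
        using IH(1) by linarith
      then have "norm_n n (xs - x j) \<le> norm_n n (xs - x0)"
        using True power2_le_imp_le norm_n_nonneg by metis
      then have "gap j \<le> (8 + 4 * \<kappa>) * Mf\<^sup>2 / \<sigma>"
        using \<kappa> True by (intro first_gap) auto
      also have "\<dots> \<le> (16 + 4 * \<kappa>) * Mf\<^sup>2 / \<sigma>"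
        using \<sigma>_pos by (intro divide_right_mono mult_right_mono) auto
      also have "\<dots> = \<beta> / (a * real (Suc p))"
        using True by (simp add: \<beta>_def a_def algebra_simps)
      finally show ?thesis .
    next
      case nonfirst: False
      then obtain i where i: "j = Suc i" "p \<ge> 1" "gap i > \<delta>" "gap i \<le> \<beta> / (a * real p)"
        using IH(5) by blast
      have "gap j + a * (gap j)\<^sup>2 \<le> gap i"
        using null_step[OF i(3)] False pos(3) by (simp add: i(1) a_def)
      then show ?thesis
        using gap_recursion_rate[OF a \<beta>, of "real p" "gap i" "gap j"] i(2,4) by (simp add: add.commute)
    qed
    have "\<delta> < \<beta> / (a * real (Suc p))" using False gap by linarith
    then have "real (Suc p) \<le> L"
      using a pos(3) unfolding L
      by (simp add: pos_less_divide_eq pos_le_divide_eq add_pos_nonneg algebra_simps)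
    moreover have "real (Suc j) \<le> real s * (L + 1) + real (Suc p)" using IH(3) by simp
    moreover have "Suc j = Suc j \<and> Suc p \<ge> 1 \<and> gap j > \<delta> \<and>
        gap j \<le> (2 + \<kappa> / 2) / (\<sigma> / (8 * Mf\<^sup>2) * real (Suc p))"
      using gap False unfolding a_def \<beta>_def by simp
    ultimately show ?thesis
      using IH(1,2) unfolding xc by blast
  qed
qed

text \<open>
  A cycle in progress counts like a full one, whence the factor \<open>s + 1\<close>.
\<close>

lemma iteration_count:
  fixes \<kappa> :: real
  assumes \<kappa>: "\<kappa> \<ge> 0" "norm_n n (xs - x0) \<le> \<kappa> * Mf / \<sigma>"
    and none: "\<And>k. k < kc J \<Longrightarrow> \<not> phi f h (zh k) - opt_value n (phi f h) \<le> ereal (2 * \<delta>)"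
  shows "\<exists>s::nat. real J \<le> (real s + 1) * ((2 + \<kappa> / 2) * (8 * Mf\<^sup>2) / (\<sigma> * \<delta>) + 1) \<and>
    real s * (2 * lam * \<delta>) \<le> (norm_n n (xs - x0))\<^sup>2 \<and>
    (1 + lam * \<mu>) ^ s * (2 * \<delta>) \<le> \<mu> * (norm_n n (xs - x0))\<^sup>2 + 2 * \<delta>"
proof -
  define L where "L = (2 + \<kappa> / 2) * (8 * Mf\<^sup>2) / (\<sigma> * \<delta>)"
  obtain s p :: nat where sp:
    "real s * (2 * lam * \<delta>) + (norm_n n (xs - xc J))\<^sup>2 \<le> (norm_n n (xs - x0))\<^sup>2"
    "(1 + lam * \<mu>) ^ s * (\<mu> * (norm_n n (xs - xc J))\<^sup>2 + 2 * \<delta>)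
      \<le> \<mu> * (norm_n n (xs - x0))\<^sup>2 + 2 * \<delta>"
    "real J \<le> real s * (L + 1) + real p" "real p \<le> L"
    using progress[OF \<kappa> none L_def order_refl] by blast
  have "real J \<le> (real s + 1) * (L + 1)" using sp(3,4) by (simp add: algebra_simps)
  moreover have "real s * (2 * lam * \<delta>) \<le> (norm_n n (xs - x0))\<^sup>2"
    using sp(1) zero_le_power2[of "norm_n n (xs - xc J)"] by linarith
  moreover have "(1 + lam * \<mu>) ^ s * (2 * \<delta>) \<le> (1 + lam * \<mu>) ^ s * (\<mu> * (norm_n n (xs - xc J))\<^sup>2 + 2 * \<delta>)"
    using pos params(3) by (intro mult_left_mono) auto
  ultimately show ?thesis
    using sp(2) unfolding L_def by (intro exI[of _ s]) linarith
qed

end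

section \<open>Combining the bounds\<close>

lemma ln_one_plus_lower: "0 \<le> y \<Longrightarrow> y / (1 + y) \<le> ln (1 + y)" for y :: real
  using ln_le_minus_one[of "1 / (1 + y)"] by (simp add: ln_div field_simps)

lemma ln_one_plus_4: "0 \<le> y \<Longrightarrow> ln (1 + 4 * y) \<le> 4 * ln (1 + y)" for y :: real
proof -
  assume y: "0 \<le> y"
  have "1 + real 4 * y \<le> (1 + y) ^ 4" using y by (intro Bernoulli_inequality) auto
  then have "ln (1 + 4 * y) \<le> ln ((1 + y) ^ 4)" using y by simp
  then show ?thesis using y by (simp add: ln_realpow)
qed

text \<open>
  In a product \<open>(s + 1) (L + 1)\<close> of the number of cycles and the length of a cycle, the mixed terms
  have to be compared with the rate one by one.
\<close>

lemma two_phase_count: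
  fixes s L A C R :: real
  assumes "s * L \<le> 4 * A * R" "s \<le> 4 * (1 + C) * R" "L \<le> A * (1 + C) * R" "A \<ge> 0" "C > 0" "R \<ge> 0"
  shows "(s + 1) * (L + 1) \<le> (4 * A + 4 * (1 + C) + A * (1 + C) + 1) * (R + 1)"
proof -
  have "(s + 1) * (L + 1) = s * L + s + L + 1" by (simp add: algebra_simps)
  also have "\<dots> \<le> 4 * A * R + 4 * (1 + C) * R + A * (1 + C) * R + 1"
    using assms by linarith
  also have "\<dots> \<le> 4 * A * R + 4 * (1 + C) * R + A * (1 + C) * R + 1
      + (4 * A + 4 * (1 + C) + A * (1 + C) + R)"
    using assms by (simp add: add_nonneg_nonneg)
  finally show ?thesis by (simp add: algebra_simps)
qed

text \<open>
  With \<open>q = Mf d/\<epsilon>\<close>, so that the rate is \<open>q\<^sup>2\<close>: the factor \<open>lam\<close> cancels in \<open>s L\<close>; \<open>s \<le> 4 q\<close> by the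
  lower bound on \<open>lam\<close>, and \<open>q \<le> C q\<^sup>2\<close>; and \<open>L \<le> A C q\<^sup>2\<close> by the upper bound on \<open>lam\<close>.
\<close>

lemma sublinear_count:
  fixes s L A C Mf d \<epsilon> \<mu> lam :: real
  assumes pos: "C > 0" "A \<ge> 0" "Mf > 0" "d > 0" "\<epsilon> > 0" "\<mu> \<ge> 0" "s \<ge> 0"
    and lam: "d / Mf \<le> lam" "lam \<le> C * d\<^sup>2 / \<epsilon>" and large: "C * Mf * d / \<epsilon> \<ge> 1"
    and s: "s * (lam * \<epsilon>) \<le> 4 * d\<^sup>2"
    and L: "L = A * Mf\<^sup>2 * lam / ((1 + lam * \<mu>) * \<epsilon>)"
  shows "(s + 1) * (L + 1) \<le> (4 * A + 4 * (1 + C) + A * (1 + C) + 1) * (Mf\<^sup>2 * d\<^sup>2 / \<epsilon>\<^sup>2 + 1)"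
proof (rule two_phase_count)
  have lam0: "lam > 0" using lam(1) pos divide_pos_pos[of d Mf] by linarith
  define q where "q = Mf * d / \<epsilon>"
  have q: "q > 0" "C * q \<ge> 1" "Mf\<^sup>2 * d\<^sup>2 / \<epsilon>\<^sup>2 = q\<^sup>2"
    using pos large by (simp_all add: q_def power_mult_distrib power_divide mult.assoc)
  have L_le: "L \<le> A * Mf\<^sup>2 * lam / \<epsilon>"
    unfolding L using pos lam0 by (intro divide_left_mono) (auto simp: mult_le_cancel_right1 intro!: mult_pos_pos add_pos_nonneg)
  have "s * L \<le> s * (A * Mf\<^sup>2 * lam / \<epsilon>)" using L_le pos by (intro mult_left_mono)
  also have "\<dots> = s * (lam * \<epsilon>) * (A * Mf\<^sup>2 / \<epsilon>\<^sup>2)"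
    using pos by (simp add: power2_eq_square)
  also have "\<dots> \<le> 4 * d\<^sup>2 * (A * Mf\<^sup>2 / \<epsilon>\<^sup>2)" using s pos by (intro mult_right_mono) auto
  also have "\<dots> = 4 * A * (Mf\<^sup>2 * d\<^sup>2 / \<epsilon>\<^sup>2)" by simp
  finally show "s * L \<le> 4 * A * (Mf\<^sup>2 * d\<^sup>2 / \<epsilon>\<^sup>2)" .
  have "s * (d / Mf * \<epsilon>) \<le> s * (lam * \<epsilon>)" using lam pos by (intro mult_left_mono mult_right_mono) auto
  also have "\<dots> \<le> 4 * d\<^sup>2" by (rule s)
  also have "\<dots> = 4 * q * (d / Mf * \<epsilon>)" using pos by (simp add: q_def power2_eq_square)
  finally have "s \<le> 4 * q" using pos by (subst (asm) mult_le_cancel_right_pos) auto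
  also have "\<dots> \<le> 4 * q * (C * q)" using q by simp
  also have "\<dots> \<le> 4 * (1 + C) * q\<^sup>2" by (simp add: power2_eq_square algebra_simps)
  finally show "s \<le> 4 * (1 + C) * (Mf\<^sup>2 * d\<^sup>2 / \<epsilon>\<^sup>2)" by (simp only: q(3))
  have "L \<le> A * Mf\<^sup>2 / \<epsilon> * lam" using L_le by simp
  also have "\<dots> \<le> A * Mf\<^sup>2 / \<epsilon> * (C * d\<^sup>2 / \<epsilon>)" using lam(2) pos by (intro mult_left_mono) auto
  also have "\<dots> = A * C * q\<^sup>2" by (simp add: q_def power2_eq_square)
  also have "\<dots> \<le> A * (1 + C) * q\<^sup>2" using pos by (intro mult_right_mono mult_left_mono) auto
  finally show "L \<le> A * (1 + C) * (Mf\<^sup>2 * d\<^sup>2 / \<epsilon>\<^sup>2)" by (simp only: q(3))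
qed (use pos in auto)

text \<open>
  With \<open>w = lam \<mu>\<close>, \<open>y = \<mu> d\<^sup>2/\<epsilon>\<close>, \<open>g = Mf\<^sup>2/(\<mu> \<epsilon>)\<close> and \<open>l = ln (1 + y)\<close>: the geometric decrease
  gives \<open>s w/(1 + w) \<le> 4 l\<close>, and \<open>L = A g w/(1 + w)\<close>, so the factor \<open>w/(1 + w)\<close> cancels in \<open>s L\<close>.  The
  lower bound on \<open>lam\<close> yields \<open>1/w \<le> C g\<close>, which controls \<open>s\<close>; the upper bound yields \<open>w \<le> C y\<close>,
  which controls \<open>L\<close> because \<open>y/(1 + y) \<le> l\<close>.
\<close>

lemma strongly_convex_count:
  fixes L A C Mf d \<epsilon> \<mu> lam :: real and s :: nat
  assumes pos: "C > 0" "A \<ge> 0" "Mf > 0" "d > 0" "\<epsilon> > 0" "\<mu> > 0"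
    and lam: "d / Mf \<le> lam" "lam \<le> C * d\<^sup>2 / \<epsilon>" and large: "C * Mf * d / \<epsilon> \<ge> 1"
    and s: "(1 + lam * \<mu>) ^ s * \<epsilon> \<le> \<mu> * (4 * d\<^sup>2) + \<epsilon>"
    and L: "L = A * Mf\<^sup>2 * lam / ((1 + lam * \<mu>) * \<epsilon>)"
  shows "(real s + 1) * (L + 1) \<le> (4 * A + 4 * (1 + C) + A * (1 + C) + 1) *
    ((Mf\<^sup>2 / (\<mu> * \<epsilon>) + 1) * ln (\<mu> * d\<^sup>2 / \<epsilon> + 1) + 1)"
proof -
  define w y g l where "w = lam * \<mu>" and "y = \<mu> * d\<^sup>2 / \<epsilon>" and "g = Mf\<^sup>2 / (\<mu> * \<epsilon>)" and "l = ln (1 + y)"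
  have lam0: "lam > 0" using lam(1) pos divide_pos_pos[of d Mf] by linarith
  have w: "w > 0" and y: "y > 0" and g: "g > 0" using pos lam0 by (simp_all add: w_def y_def g_def)
  have l: "y / (1 + y) \<le> l" "l > 0" using ln_one_plus_lower[of y] y by (simp_all add: l_def)
  have L_eq: "L = A * g * (w / (1 + w))" using pos by (simp add: L g_def w_def mult_ac)
  have "(1 + w) ^ s \<le> 1 + 4 * y"
    using s pos by (simp add: w_def y_def field_simps)
  then have "ln ((1 + w) ^ s) \<le> ln (1 + 4 * y)"
    using w by (subst ln_le_cancel_iff) (auto intro!: add_pos_pos zero_less_power simp: y)
  also have "\<dots> \<le> 4 * l" unfolding l_def using y by (intro ln_one_plus_4) simp
  finally have "s * ln (1 + w) \<le> 4 * l" using w by (simp add: ln_realpow)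
  moreover have "s * (w / (1 + w)) \<le> s * ln (1 + w)"
    using w ln_one_plus_lower[of w] by (intro mult_left_mono) auto
  ultimately have sw: "s * (w / (1 + w)) \<le> 4 * l" by linarith
  have "1 / w \<le> C * g"
  proof -
    have "1 / lam \<le> Mf / d" using lam(1) pos lam0 by (simp add: field_simps)
    also have "\<dots> \<le> (C * Mf * d / \<epsilon>) * (Mf / d)" using mult_right_mono[OF large, of "Mf / d"] pos by simp
    also have "\<dots> = C * g * \<mu>" using pos by (simp add: g_def power2_eq_square)
    finally show ?thesis using pos lam0 by (simp add: w_def field_simps)
  qed
  have "s = s * (w / (1 + w)) * ((1 + w) / w)" using w by simp
  also have "\<dots> \<le> 4 * l * ((1 + w) / w)" using sw w by (intro mult_right_mono) auto
  also have "\<dots> = 4 * l * (1 + 1 / w)" using w by (simp add: field_simps)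
  also have "\<dots> \<le> 4 * l * (1 + C * g)" using l \<open>1 / w \<le> C * g\<close> by (intro mult_left_mono) auto
  also have "\<dots> \<le> 4 * l * ((1 + C) * (g + 1))" using l g pos by (intro mult_left_mono) (auto simp: algebra_simps)
  also have "\<dots> = 4 * (1 + C) * ((g + 1) * l)" by (simp only: mult_ac)
  finally have s_le: "real s \<le> 4 * (1 + C) * ((g + 1) * l)" .
  have "s * L = A * g * (s * (w / (1 + w)))" by (simp add: L_eq)
  also have "\<dots> \<le> A * g * (4 * l)" using sw pos g by (intro mult_left_mono) auto
  also have "\<dots> = 4 * A * (g * l)" by simp
  also have "\<dots> \<le> 4 * A * ((g + 1) * l)" using pos l by (intro mult_left_mono mult_right_mono) auto
  finally have sL: "s * L \<le> 4 * A * ((g + 1) * l)" .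
  have "w \<le> C * y"
    using mult_right_mono[OF lam(2), of \<mu>] pos by (simp add: w_def y_def mult_ac)
  then have "w / (1 + w) \<le> (1 + C) * (y / (1 + y))"
  proof -
    have "w * (1 + y) \<le> C * y + w * y" using \<open>w \<le> C * y\<close> by (simp add: algebra_simps)
    also have "\<dots> \<le> (1 + C) * y * (1 + w)"
      using pos y w by (simp add: algebra_simps add_increasing)
    finally show ?thesis using y w by (simp add: frac_le_eq divide_le_eq pos_divide_le_eq pos_le_divide_eq mult_ac)
  qed
  also have "\<dots> \<le> (1 + C) * l" using l(1) pos by (intro mult_left_mono) auto
  finally have "L \<le> A * g * ((1 + C) * l)" unfolding L_eq using pos g by (intro mult_left_mono) auto
  also have "\<dots> = A * (1 + C) * (g * l)" by simp
  also have "\<dots> \<le> A * (1 + C) * ((g + 1) * l)" using pos l by (intro mult_left_mono mult_right_mono) auto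
  finally have L_le: "L \<le> A * (1 + C) * ((g + 1) * l)" .
  show ?thesis
    using two_phase_count[OF sL s_le L_le pos(2,1)] g l by (simp add: g_def l_def y_def add.commute)
qed

lemma count_le_rate:
  fixes L A C Mf d \<epsilon> \<mu> lam :: real and s :: nat
  assumes pos: "C > 0" "A \<ge> 0" "Mf > 0" "d > 0" "\<epsilon> > 0" "\<mu> \<ge> 0"
    and lam: "d / Mf \<le> lam" "lam \<le> C * d\<^sup>2 / \<epsilon>" and large: "C * Mf * d / \<epsilon> \<ge> 1"
    and s: "real s * (lam * \<epsilon>) \<le> 4 * d\<^sup>2" "(1 + lam * \<mu>) ^ s * \<epsilon> \<le> \<mu> * (4 * d\<^sup>2) + \<epsilon>"
    and L: "L = A * Mf\<^sup>2 * lam / ((1 + lam * \<mu>) * \<epsilon>)"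
  shows "(real s + 1) * (L + 1) \<le>
    (4 * A + 4 * (1 + C) + A * (1 + C) + 1) * (rpb_rate Mf \<mu> d \<epsilon> + 1)"
  using sublinear_count[OF pos _ lam large s(1) L] strongly_convex_count[OF pos(1-5) _ lam large s(2) L] pos(6)
  unfolding rpb_rate_def min_def by auto

lemma rpb_rate_nonneg:
  assumes "\<epsilon> > 0" "\<mu> \<ge> 0" shows "rpb_rate Mf \<mu> d \<epsilon> \<ge> 0"
  unfolding rpb_rate_def using assms by (auto simp: add_increasing)

text \<open>
  The constant is \<open>c + 1\<close> rather than \<open>c\<close> to make room for rounding the bound down to an iteration
  index \<open>J\<close>: without a solution after \<open>J\<close> iterations, \<open>J \<le> c (R + 1) \<le> (c + 1) (R + 1) - 1 < J\<close>.
\<close>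

theorem rpb_complexity:
  fixes C C' \<mu> :: real
  defines "c \<equiv> 4 * (16 * (3 + C')) + 4 * (1 + C) + 16 * (3 + C') * (1 + C) + 1"
  assumes C: "C > 0" "C' > 0" and \<epsilon>: "\<epsilon> > 0" and x0: "x0 \<in> edom n h"
    and basic: "basic_assumptions n f f' h Mf Mh \<mu>"
    and pos: "Mf > 0" "dist0 n f h x0 > 0"
    and large: "C * Mf * dist0 n f h x0 / \<epsilon> \<ge> 1"
    and \<mu>: "\<mu> \<le> C' * Mf / dist0 n f h x0"
    and lam: "dist0 n f h x0 / Mf \<le> lam" "lam \<le> C * (dist0 n f h x0)\<^sup>2 / \<epsilon>"
  shows "rpb_complexity_bound n f f' h x0 lam (\<epsilon> / 2) \<epsilon> ((c + 1) * (rpb_rate Mf \<mu> (dist0 n f h x0) \<epsilon> + 1))"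
proof -
  interpret basic_assumptions n f f' h Mf Mh \<mu> by (rule basic)
  define d where "d = dist0 n f h x0"
  define R where "R = rpb_rate Mf \<mu> d \<epsilon>"
  note pos' = pos(2)[folded d_def] and large' = large[folded d_def] and lam' = lam[folded d_def]
    and \<mu>' = \<mu>[folded d_def]
  have lam0: "lam > 0" using lam' pos(1) pos' divide_pos_pos[of d Mf] by linarith
  have R: "R \<ge> 0" unfolding R_def using \<epsilon> params by (intro rpb_rate_nonneg)
  have c: "c \<ge> 0" using C by (simp add: c_def)
  \<comment> \<open>The factor 2 makes room for an approximate nearest minimizer, which exists because \<open>d > 0\<close>.\<close>
  have "bdd_below ((\<lambda>xs. norm_n n (x0 - xs)) ` minimizers n (phi f h))" by (rule bdd_belowI2[of _ 0]) simp
  then obtain xs where xs: "xs \<in> minimizers n (phi f h)" "norm_n n (x0 - xs) < 2 * d"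
    using cINF_less_iff[OF minimizer, of "\<lambda>xs. norm_n n (x0 - xs)" "2 * d"] pos'
    unfolding d_def dist0_def by auto
  define \<sigma> where "\<sigma> = \<mu> + 1 / lam"
  have \<sigma>: "\<sigma> > 0" using params(3) lam0 by (simp add: \<sigma>_def add_nonneg_pos)
  \<comment> \<open>Both parameter restrictions in one: they bound \<open>d / lam\<close> and \<open>d * \<mu>\<close>, respectively.\<close>
  have "d * \<sigma> \<le> (1 + C') * Mf"
  proof -
    have "d * \<mu> \<le> C' * Mf" using \<mu>' pos' by (simp add: pos_le_divide_eq mult.commute)
    moreover have "d / lam \<le> Mf" using lam'(1) lam0 pos by (simp add: field_simps)
    ultimately show ?thesis by (simp add: \<sigma>_def algebra_simps)
  qed
  then have "2 * d \<le> 2 * (1 + C') * Mf / \<sigma>" using \<sigma> by (simp add: pos_le_divide_eq algebra_simps)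
  then have dist: "norm_n n (xs - x0) \<le> 2 * (1 + C') * Mf / \<sigma>"
    using xs(2) by (simp add: norm_n_minus_commute[of n xs])
  have dist2: "(norm_n n (xs - x0))\<^sup>2 \<le> 4 * d\<^sup>2"
    using power_mono[of "norm_n n (xs - x0)" "2 * d" 2] xs(2)
    by (simp add: norm_n_minus_commute[of n xs] power_mult_distrib)
  show ?thesis
    unfolding rpb_complexity_bound_def
  proof (intro allI impI)
    fix x xc xt S zh kc m t
    assume "rpb_run n f f' h x0 lam (\<epsilon> / 2) x xc xt S zh kc m t"
    then interpret rpb_run n f f' h x0 lam "\<epsilon> / 2" x xc xt S zh kc m t .
    interpret run: rpb_analysis n f f' h Mf Mh \<mu> x0 lam "\<epsilon> / 2" x xc xt S zh kc m t xs
      by unfold_locales (use pos lam0 \<epsilon> x0 xs in auto)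
    define J where "J = nat \<lfloor>(c + 1) * (R + 1)\<rfloor>"
    have B: "(c + 1) * (R + 1) \<ge> 0" using c R by simp
    have J: "real J \<le> (c + 1) * (R + 1)" "(c + 1) * (R + 1) < real J + 1"
      using B unfolding J_def by (simp_all add: floor_less_iff) 
    have "\<exists>k<kc J. phi f h (zh k) - opt_value n (phi f h) \<le> ereal \<epsilon>"
    proof (rule ccontr)
      assume "\<not> ?thesis"
      then have none: "\<not> phi f h (zh k) - opt_value n (phi f h) \<le> ereal (2 * (\<epsilon> / 2))" if "k < kc J" for k
        using that by auto
      have run\<sigma>: "run.\<sigma> = \<sigma>" by (simp add: run.\<sigma>_def \<sigma>_def)
      obtain s :: nat where s:
        "real J \<le> (real s + 1) * ((2 + 2 * (1 + C') / 2) * (8 * Mf\<^sup>2) / (\<sigma> * (\<epsilon> / 2)) + 1)"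
        "real s * (2 * lam * (\<epsilon> / 2)) \<le> (norm_n n (xs - x0))\<^sup>2"
        "(1 + lam * \<mu>) ^ s * (2 * (\<epsilon> / 2)) \<le> \<mu> * (norm_n n (xs - x0))\<^sup>2 + 2 * (\<epsilon> / 2)"
        using run.iteration_count[OF _ _ none, of "2 * (1 + C')"] dist C unfolding run\<sigma> by auto
      have "real J \<le> c * (R + 1)"
        unfolding c_def R_def
      proof (rule order_trans[OF s(1) count_le_rate])
        show "real s * (lam * \<epsilon>) \<le> 4 * d\<^sup>2" using s(2) dist2 by simp
        show "(1 + lam * \<mu>) ^ s * \<epsilon> \<le> \<mu> * (4 * d\<^sup>2) + \<epsilon>"
          using s(3) mult_left_mono[OF dist2 params(3)] by simp
        have "\<sigma> = (1 + lam * \<mu>) / lam" using lam0 by (simp add: \<sigma>_def field_simps)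
        then show "(2 + 2 * (1 + C') / 2) * (8 * Mf\<^sup>2) / (\<sigma> * (\<epsilon> / 2)) =
            16 * (3 + C') * Mf\<^sup>2 * lam / ((1 + lam * \<mu>) * \<epsilon>)"
          by simp
      qed (use C pos pos' \<epsilon> params lam' large' in auto)
      also have "\<dots> \<le> (c + 1) * (R + 1) - 1" using R by (simp add: algebra_simps)
      finally show False using J(2) by linarith
    qed
    then show "\<exists>j k. k < kc j \<and> phi f h (zh k) - opt_value n (phi f h) \<le> ereal \<epsilon> \<and>
        real j \<le> (c + 1) * (rpb_rate Mf \<mu> (dist0 n f h x0) \<epsilon> + 1)"
      using J(1) unfolding R_def d_def by blast
  qed
qed

theorem corollary3p2:
  fixes C C' :: real
  assumes "C > 0" "C' > 0"
  shows "\<exists>c>0. \<forall>(n::nat) (f :: point \<Rightarrow> ereal) (f' :: point \<Rightarrow> point) (h :: point \<Rightarrow> ereal)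
            (x0 :: point) (Mf :: real) (Mh :: ereal) (\<mu> :: real) (\<epsilon> :: real).
     \<epsilon> > 0 \<longrightarrow> x0 \<in> edom n h \<longrightarrow> basic_assumptions n f f' h Mf Mh \<mu> \<longrightarrow>
     C * Mf * dist0 n f h x0 / \<epsilon> \<ge> 1 \<longrightarrow> \<mu> \<le> C' * Mf / dist0 n f h x0 \<longrightarrow>
       {dist0 n f h x0 / Mf .. C * (dist0 n f h x0)\<^sup>2 / \<epsilon>} \<noteq> {} \<and>
       (\<forall>lam \<in> {dist0 n f h x0 / Mf .. C * (dist0 n f h x0)\<^sup>2 / \<epsilon>}.
          rpb_complexity_bound n f f' h x0 lam (\<epsilon> / 2) \<epsilon>
            (c * (rpb_rate Mf \<mu> (dist0 n f h x0) \<epsilon> + 1)))"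
proof -
  define c where "c = 4 * (16 * (3 + C')) + 4 * (1 + C) + 16 * (3 + C') * (1 + C) + 1"
  have "c + 1 > 0" using assms by (simp add: c_def add_pos_pos)
  moreover have "{dist0 n f h x0 / Mf .. C * (dist0 n f h x0)\<^sup>2 / \<epsilon>} \<noteq> {} \<and>
       (\<forall>lam \<in> {dist0 n f h x0 / Mf .. C * (dist0 n f h x0)\<^sup>2 / \<epsilon>}.
          rpb_complexity_bound n f f' h x0 lam (\<epsilon> / 2) \<epsilon>
            ((c + 1) * (rpb_rate Mf \<mu> (dist0 n f h x0) \<epsilon> + 1)))"
    if \<epsilon>: "\<epsilon> > 0" and x0: "x0 \<in> edom n h" and basic: "basic_assumptions n f f' h Mf Mh \<mu>"
      and large: "C * Mf * dist0 n f h x0 / \<epsilon> \<ge> 1" and \<mu>: "\<mu> \<le> C' * Mf / dist0 n f h x0"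
    for n f f' h x0 Mf Mh \<mu> \<epsilon>
  proof -
    interpret basic_assumptions n f f' h Mf Mh \<mu> by (rule basic)
    have "Mf \<noteq> 0" "dist0 n f h x0 \<noteq> 0" using large by auto
    moreover have "dist0 n f h x0 \<ge> 0"
      unfolding dist0_def by (rule cINF_greatest[OF minimizer]) simp
    ultimately have pos: "Mf > 0" "dist0 n f h x0 > 0" using params(1) by auto
    have "dist0 n f h x0 / Mf \<le> (C * Mf * dist0 n f h x0 / \<epsilon>) * (dist0 n f h x0 / Mf)"
      using mult_right_mono[OF large, of "dist0 n f h x0 / Mf"] pos by simp
    also have "\<dots> = C * (dist0 n f h x0)\<^sup>2 / \<epsilon>" using pos by (simp add: power2_eq_square)
    finally show ?thesis
      using rpb_complexity[OF assms \<epsilon> x0 basic pos large \<mu>, folded c_def] by simp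
  qed
  ultimately show ?thesis by (intro exI[of _ "c + 1"]) blast
qed

end
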